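(* Let $\mathfrak{F}$ be a hereditary formation and $\pi=\pi(\mathfrak{F})$. Then $\mathfrak{F}$ is recognized by the Gruenberg-Kegel (prime) graph function $\Gamma_p$ if and only if $\mathfrak{F}=\mathfrak{G}_\pi$.
   Context: All groups are finite; classes of groups are closed under isomorphism. $\pi(G)$ is the set of prime divisors of $|G|$ and $\pi(\mathfrak{F})=\bigcup_{G\in\mathfrak{F}}\pi(G)$. A formation is a class of groups $\mathfrak{F}$ closed under homomorphic images and such that $G/N_1,\dots,G/N_n\in\mathfrak{F}$ with $N_i\trianglelefteq G$ and $\bigcap_i N_i=1$ imply $G\in\mathfrak{F}$; it is hereditary if it is closed under subgroups. $\mathfrak{G}_\pi$ is the class of all $\pi$-groups; for $\pi=\emptyset$ it is the class of unit (trivial) groups. The Gruenberg-Kegel (prime) graph $\Gamma_p(G)$ of a group $G$ (here the subscript $p$ is merely part of the name) is the graph with vertex set $\pi(G)$ in which $(r,q)$ is an edge if and only if $G$ contains an element of order $rq$. Graphs are equal if they have the same vertex sets and the same edge sets. A class $\mathfrak{X}$ is recognized by a function $\Gamma$ from groups to graphs if $G_1\in\mathfrak{X}$ and $\Gamma(G_1)=\Gamma(G_2)$ imply $G_2\in\mathfrak{X}$. *)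

theory Defs
  imports "HOL-Algebra.Multiplicative_Group" "HOL-Computational_Algebra.Primes"
    "Graph_Theory.Pair_Digraph"
begin

definition finite_group :: "('a, 'b) monoid_scheme \<Rightarrow> bool" where
  "finite_group G \<longleftrightarrow> group G \<and> finite (carrier G)"

text \<open>
  Every finite group is isomorphic to one whose elements are natural numbers. A class of
  finite groups that is closed under isomorphism is therefore represented faithfully by the
  set of its members of type \<^typ>\<open>nat monoid\<close>.
\<close>

definition group_class :: "nat monoid set \<Rightarrow> bool" where
  "group_class \<FF> \<longleftrightarrow>
     (\<forall>G\<in>\<FF>. finite_group G) \<and>
     (\<forall>G\<in>\<FF>. \<forall>H :: nat monoid. finite_group H \<longrightarrow> G \<cong> H \<longrightarrow> H \<in> \<FF>)"

text \<open>Membership in a class for a group of another type, such as a quotient \<open>G Mod N\<close>.\<close>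

definition belongs_to :: "('a, 'b) monoid_scheme \<Rightarrow> nat monoid set \<Rightarrow> bool" where
  "belongs_to G \<FF> \<longleftrightarrow> (\<exists>H\<in>\<FF>. G \<cong> H)"

definition group_primes :: "('a, 'b) monoid_scheme \<Rightarrow> nat set" where
  "group_primes G = prime_factors (order G)"

definition class_primes :: "nat monoid set \<Rightarrow> nat set" where
  "class_primes \<FF> = (\<Union>G\<in>\<FF>. group_primes G)"

text \<open>
  The empty class satisfies these conditions; that a formation is nonempty has to be assumed
  separately where it matters.
\<close>

definition formation :: "nat monoid set \<Rightarrow> bool" where
  "formation \<FF> \<longleftrightarrow>
     group_class \<FF> \<and>
     (\<forall>G\<in>\<FF>. \<forall>H :: nat monoid. finite_group H \<longrightarrow> epi G H \<noteq> {} \<longrightarrow> H \<in> \<FF>) \<and>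
     (\<forall>(G :: nat monoid) (n :: nat) N.
        finite_group G \<longrightarrow> n \<ge> 1 \<longrightarrow>
        (\<forall>i\<in>{1..n}. N i \<lhd> G \<and> belongs_to (G Mod N i) \<FF>) \<longrightarrow>
        (\<Inter>i\<in>{1..n}. N i) = {\<one>\<^bsub>G\<^esub>} \<longrightarrow>
        G \<in> \<FF>)"

definition hereditary :: "nat monoid set \<Rightarrow> bool" where
  "hereditary \<FF> \<longleftrightarrow> (\<forall>G\<in>\<FF>. \<forall>H. subgroup H G \<longrightarrow> G\<lparr>carrier := H\<rparr> \<in> \<FF>)"

definition pi_groups :: "nat set \<Rightarrow> nat monoid set" where
  "pi_groups \<pi> = {G. finite_group G \<and> group_primes G \<subseteq> \<pi>}"

text \<open>
  The prime graph is a simple undirected graph, so adjacent primes are distinct; an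
  undirected edge is represented by its two arcs. Equality of records of this type is equality
  of vertex sets together with equality of edge sets.
\<close>

definition prime_graph :: "('a, 'b) monoid_scheme \<Rightarrow> nat pair_pre_digraph" where
  "prime_graph G =
     \<lparr> pverts = group_primes G,
       parcs = {(r, q). r \<in> group_primes G \<and> q \<in> group_primes G \<and> r \<noteq> q \<and>
                        (\<exists>x\<in>carrier G. group.ord G x = r * q)} \<rparr>"

lemma pair_graph_prime_graph: "pair_graph (prime_graph G)"
proof -
  have "parcs (prime_graph G) \<subseteq> group_primes G \<times> group_primes G"
    by (auto simp: prime_graph_def)
  moreover have "finite (group_primes G)"
    by (simp add: group_primes_def)
  ultimately have "finite (parcs (prime_graph G))"
    using finite_subset by blast
  then show ?thesis
    by unfold_locales
      (auto simp: prime_graph_def group_primes_def symmetric_def sym_def mult.commute)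
qed

definition recognized_by :: "nat monoid set \<Rightarrow> (nat monoid \<Rightarrow> 'g) \<Rightarrow> bool" where
  "recognized_by \<XX> \<Gamma> \<longleftrightarrow>
     (\<forall>G\<^sub>1 G\<^sub>2. finite_group G\<^sub>1 \<longrightarrow> finite_group G\<^sub>2 \<longrightarrow>
        G\<^sub>1 \<in> \<XX> \<longrightarrow> \<Gamma> G\<^sub>1 = \<Gamma> G\<^sub>2 \<longrightarrow> G\<^sub>2 \<in> \<XX>)"

end

theory Submission
  imports Defs "HOL-Algebra.Sylow" "HOL-Algebra.Weak_Morphisms" "HOL-Library.Nat_Bijection"
begin

text \<open>
  If \<open>\<FF> = \<GG>\<^sub>\<pi>\<close>, recognition holds because the vertex set of the prime graph of a group
  determines whether that group is a \<open>\<pi>\<close>-group.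

  For the converse, the point is that a group with an element whose order is the product of all
  its prime divisors has a complete prime graph (\<open>prime_graph_complete\<close>), so its graph depends on
  its prime divisors alone. For each finite \<open>S \<subseteq> \<pi>\<close> the class \<open>\<FF>\<close> contains a cyclic group \<open>C\<close>
  of order \<open>\<Prod>S\<close> (\<open>cyclic_in_hereditary_formation\<close>): elements of prime order exist by Cauchy's
  theorem, a formation is closed under direct products, and heredity allows one to pass from a
  product to the cyclic subgroup generated by an element of it. Now let \<open>G\<close> be any
  \<open>\<pi>\<close>-group and take \<open>S = \<pi>(G)\<close>. The groups \<open>C\<close> and \<open>G \<times> C\<close> have the same prime divisors, and both
  contain an element of order \<open>\<Prod>S\<close>, so they have the same prime graph. Recognition puts \<open>G \<times> C\<close>
  into \<open>\<FF>\<close>, and therefore also its homomorphic image \<open>G\<close>.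
\<close>

section \<open>Direct products of groups on natural numbers\<close>

text \<open>
  Classes consist of groups on natural numbers, so the direct product is transported back to
  \<^typ>\<open>nat\<close> along the pairing bijection.
\<close>

definition nat_DirProd :: "nat monoid \<Rightarrow> nat monoid \<Rightarrow> nat monoid" where
  "nat_DirProd G H = image_group prod_encode (G \<times>\<times> H)"

lemma carrier_nat_DirProd:
  "carrier (nat_DirProd G H) = prod_encode ` (carrier G \<times> carrier H)"
  by (simp add: nat_DirProd_def image_group_carrier)

lemma prod_encode_iso: "prod_encode \<in> iso (G \<times>\<times> H) (nat_DirProd G H)"
  unfolding nat_DirProd_def by (rule inj_imp_image_group_iso) (rule inj_prod_encode)

lemma group_nat_DirProd:
  assumes "group G" "group H"
  shows "group (nat_DirProd G H)"
  unfolding nat_DirProd_def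
  by (rule group.inj_imp_image_group_is_group[OF DirProd_group[OF assms] inj_prod_encode])

lemma finite_group_nat_DirProd:
  assumes "finite_group G" "finite_group H"
  shows "finite_group (nat_DirProd G H)"
  using assms by (simp add: finite_group_def group_nat_DirProd carrier_nat_DirProd)

lemma nat_DirProd_fst_hom: "(\<lambda>z. fst (prod_decode z)) \<in> hom (nat_DirProd G H) G"
  and nat_DirProd_snd_hom: "(\<lambda>z. snd (prod_decode z)) \<in> hom (nat_DirProd G H) H"
  by (auto simp: hom_def carrier_nat_DirProd nat_DirProd_def image_group_def mult_DirProd'
      inv_into_f_f[OF inj_prod_encode])

lemma nat_DirProd_fst_surj:
  assumes "group H"
  shows "(\<lambda>z. fst (prod_decode z)) ` carrier (nat_DirProd G H) = carrier G"
  using group.is_monoid[OF assms] monoid.one_closed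
  by (force simp: carrier_nat_DirProd image_image)

lemma nat_DirProd_snd_surj:
  assumes "group G"
  shows "(\<lambda>z. snd (prod_decode z)) ` carrier (nat_DirProd G H) = carrier H"
  using group.is_monoid[OF assms] monoid.one_closed
  by (force simp: carrier_nat_DirProd image_image)

lemma group_primes_nat_DirProd:
  assumes "finite_group G" "finite_group H"
  shows "group_primes (nat_DirProd G H) = group_primes G \<union> group_primes H"
proof -
  have "order (nat_DirProd G H) = order G * order H"
    using card_image[OF inj_prod_encode[of "carrier G \<times> carrier H"]]
    by (simp add: order_def carrier_nat_DirProd card_cartesian_product)
  moreover have "order G > 0" "order H > 0"
    using assms by (auto simp: finite_group_def group.is_monoid monoid.order_gt_0_iff_finite)
  ultimately show ?thesis
    by (simp add: group_primes_def prime_factors_product)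
qed

text \<open>
  The two projections are homomorphisms that jointly detect the identity, so \<open>(x, y)\<^sup>n = 1\<close> exactly
  when both orders divide \<open>n\<close>.
\<close>

lemma ord_nat_DirProd:
  assumes "group G" "group H" "x \<in> carrier G" "y \<in> carrier H"
  shows "group.ord (nat_DirProd G H) (prod_encode (x, y)) = lcm (group.ord G x) (group.ord H y)"
proof -
  interpret G: group G by fact
  interpret H: group H by fact
  interpret P: group "nat_DirProd G H" by (rule group_nat_DirProd) fact+
  interpret f: group_hom "nat_DirProd G H" G "\<lambda>z. fst (prod_decode z)"
    by unfold_locales (rule nat_DirProd_fst_hom)
  interpret s: group_hom "nat_DirProd G H" H "\<lambda>z. snd (prod_decode z)"
    by unfold_locales (rule nat_DirProd_snd_hom)
  let ?z = "prod_encode (x, y)"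
  have z: "?z \<in> carrier (nat_DirProd G H)"
    using assms by (auto simp: carrier_nat_DirProd)
  have eq_one: "w = \<one>\<^bsub>nat_DirProd G H\<^esub> \<longleftrightarrow>
      fst (prod_decode w) = \<one>\<^bsub>G\<^esub> \<and> snd (prod_decode w) = \<one>\<^bsub>H\<^esub>" for w
    by (metis f.hom_one s.hom_one prod_decode_inverse prod.collapse)
  have "?z [^]\<^bsub>nat_DirProd G H\<^esub> n = \<one>\<^bsub>nat_DirProd G H\<^esub> \<longleftrightarrow>
      lcm (G.ord x) (H.ord y) dvd n" for n :: nat
    using assms f.hom_nat_pow[OF z, of n] s.hom_nat_pow[OF z, of n]
    by (simp add: eq_one G.pow_eq_id H.pow_eq_id)
  then show ?thesis
    using P.ord_unique[OF z] by blast
qed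

section \<open>Element orders and the prime graph\<close>

text \<open>Cauchy's theorem: Sylow's theorem gives a subgroup of order \<open>p\<close>, and each of its nontrivial elements
  has order \<open>p\<close>.\<close>

lemma exists_element_of_prime_order:
  assumes "finite_group G" "p \<in> group_primes G"
  obtains x where "x \<in> carrier G" "group.ord G x = p"
proof -
  interpret group G using assms by (simp add: finite_group_def)
  have fin: "finite (carrier G)" using assms by (simp add: finite_group_def)
  have p: "prime p" "p dvd order G"
    using assms by (auto simp: group_primes_def)
  then obtain m where "order G = p ^ 1 * m" by auto
  then obtain K where K: "subgroup K G" "card K = p"
    using sylow_thm[OF p(1) is_group, of 1 m] fin by auto
  then have "card K > card {\<one>\<^bsub>G\<^esub>}"
    using p prime_gt_1_nat by simp
  then obtain x where x: "x \<in> K" "x \<noteq> \<one>\<^bsub>G\<^esub>"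
    by (metis card.empty card_mono finite.emptyI finite_insert insertCI linorder_not_le subsetI)
  then have xG: "x \<in> carrier G" using K subgroup.mem_carrier by metis
  have "x [^]\<^bsub>G\<lparr>carrier := K\<rparr>\<^esub> order (G\<lparr>carrier := K\<rparr>) = \<one>\<^bsub>G\<^esub>"
    using group.pow_order_eq_1[OF subgroup.subgroup_is_group[OF K(1) is_group]] x by simp
  then have "x [^]\<^bsub>G\<^esub> p = \<one>\<^bsub>G\<^esub>"
    using K by (simp add: order_def nat_pow_consistent[symmetric])
  then have "ord x dvd p" using pow_eq_id xG by simp
  then have "ord x = p"
    using p(1) x(2) xG ord_eq_1 by (auto simp: prime_nat_iff)
  with xG show thesis by (rule that)
qed

text \<open>For distinct prime divisors \<open>r\<close>, \<open>q\<close> of the order of \<open>G\<close>, a suitable power of \<open>x\<close> has order \<open>r q\<close>.\<close>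

lemma prime_graph_complete:
  assumes "finite_group G" "x \<in> carrier G" "group.ord G x = \<Prod>(group_primes G)"
  shows "prime_graph G = \<lparr> pverts = group_primes G,
    parcs = {(r, q). r \<in> group_primes G \<and> q \<in> group_primes G \<and> r \<noteq> q} \<rparr>"
proof -
  interpret group G using assms by (simp add: finite_group_def)
  have "\<exists>y\<in>carrier G. ord y = r * q"
    if "r \<in> group_primes G" "q \<in> group_primes G" "r \<noteq> q" for r q
  proof -
    have "finite (group_primes G)" by (simp add: group_primes_def)
    then have "\<Prod>(group_primes G) = r * q * \<Prod>(group_primes G - {r, q})"
      using that prod.subset_diff[of "{r, q}" "group_primes G" id] by (simp add: mult.commute)
    then obtain k where k: "ord x = r * q * k" using assms(3) by auto
    have "ord x > 0"
      using assms(1,2) ord_ge_1 by (force simp: finite_group_def)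
    then have "k > 0" "ord (x [^]\<^bsub>G\<^esub> k) = r * q"
      using k ord_pow_gen[OF assms(2), of k] by auto
    then show ?thesis using assms(2) by (intro bexI[of _ "x [^]\<^bsub>G\<^esub> k"]) auto
  qed
  then show ?thesis by (auto simp: prime_graph_def)
qed

section \<open>Formations\<close>

lemma formation_finite_group:
  assumes "formation \<FF>" "G \<in> \<FF>"
  shows "finite_group G"
  using assms unfolding formation_def group_class_def by blast

text \<open>
  The two coordinate kernels of a direct product meet trivially, and their quotients are the
  factors.
\<close>

lemma formation_nat_DirProd:
  assumes "formation \<FF>" "G \<in> \<FF>" "H \<in> \<FF>"
  shows "nat_DirProd G H \<in> \<FF>"
proof -
  have fg: "finite_group G" "finite_group H"
    using assms formation_finite_group by blast+
  interpret G: group G using fg by (simp add: finite_group_def)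
  interpret H: group H using fg by (simp add: finite_group_def)
  let ?P = "nat_DirProd G H"
  interpret P: group ?P by (rule group_nat_DirProd) unfold_locales
  interpret f: group_hom ?P G "\<lambda>z. fst (prod_decode z)"
    by unfold_locales (rule nat_DirProd_fst_hom)
  interpret s: group_hom ?P H "\<lambda>z. snd (prod_decode z)"
    by unfold_locales (rule nat_DirProd_snd_hom)
  define N where "N i = (if i = (1::nat) then kernel ?P G (\<lambda>z. fst (prod_decode z))
    else kernel ?P H (\<lambda>z. snd (prod_decode z)))" for i
  have "?P Mod kernel ?P G (\<lambda>z. fst (prod_decode z)) \<cong> G"
    by (rule f.FactGroup_iso[OF nat_DirProd_fst_surj[OF H.is_group]])
  moreover have "?P Mod kernel ?P H (\<lambda>z. snd (prod_decode z)) \<cong> H"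
    by (rule s.FactGroup_iso[OF nat_DirProd_snd_surj[OF G.is_group]])
  ultimately have quot: "\<forall>i\<in>{1..2}. N i \<lhd> ?P \<and> belongs_to (?P Mod N i) \<FF>"
    using assms f.normal_kernel s.normal_kernel by (auto simp: N_def belongs_to_def)
  have "{1..2} = {1, 2::nat}" by auto
  then have "(\<Inter>i\<in>{1..2}. N i) = N 1 \<inter> N 2" by simp
  also have "\<dots> = {\<one>\<^bsub>?P\<^esub>}"
  proof -
    have "w = \<one>\<^bsub>?P\<^esub>" if "fst (prod_decode w) = \<one>\<^bsub>G\<^esub>" "snd (prod_decode w) = \<one>\<^bsub>H\<^esub>" for w
      using that by (metis f.hom_one s.hom_one prod_decode_inverse prod.collapse)
    then show ?thesis by (auto simp: N_def kernel_def)
  qed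
  finally have int: "(\<Inter>i\<in>{1..2}. N i) = {\<one>\<^bsub>?P\<^esub>}" .
  have *: "\<forall>(G :: nat monoid) (n :: nat) N.
        finite_group G \<longrightarrow> n \<ge> 1 \<longrightarrow>
        (\<forall>i\<in>{1..n}. N i \<lhd> G \<and> belongs_to (G Mod N i) \<FF>) \<longrightarrow>
        (\<Inter>i\<in>{1..n}. N i) = {\<one>\<^bsub>G\<^esub>} \<longrightarrow> G \<in> \<FF>"
    using assms(1) unfolding formation_def by blast
  show ?thesis
    by (rule *[rule_format, of ?P 2 N])
      (use finite_group_nat_DirProd[OF fg] quot int in auto)
qed

lemma cyclic_in_hereditary_formation:
  assumes "formation \<FF>" "hereditary \<FF>" "\<FF> \<noteq> {}" "finite S" "S \<subseteq> class_primes \<FF>"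
  obtains C x where "C \<in> \<FF>" "group_primes C = S" "x \<in> carrier C" "group.ord C x = \<Prod>S"
proof -
  note fg = formation_finite_group[OF assms(1)]
  have S_prime: "prime p" if "p \<in> S" for p
    using that assms(5) by (auto simp: class_primes_def group_primes_def)
  \<comment> \<open>Some member of the class has an element of order \<open>\<Prod>S\<close>; primes are added one at a time by
    passing to direct products.\<close>
  have "\<exists>K\<in>\<FF>. \<exists>x\<in>carrier K. group.ord K x = \<Prod>S"
    using assms(4,5) S_prime
  proof (induction S rule: finite_induct)
    case empty
    obtain K where K: "K \<in> \<FF>" using assms(3) by blast
    then interpret group K using fg by (simp add: finite_group_def)
    show ?case using K by (auto intro!: bexI[of _ K] bexI[of _ "\<one>\<^bsub>K\<^esub>"])
  next
    case (insert p S)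
    then obtain K x where K: "K \<in> \<FF>" "x \<in> carrier K" "group.ord K x = \<Prod>S" by auto
    from insert obtain H where H: "H \<in> \<FF>" "p \<in> group_primes H"
      by (auto simp: class_primes_def)
    then obtain y where y: "y \<in> carrier H" "group.ord H y = p"
      using exists_element_of_prime_order fg by metis
    have grp: "group H" "group K" using H K fg by (auto simp: finite_group_def)
    have "coprime p (\<Prod>S)"
      by (intro prod_coprime_right primes_coprime) (use insert in auto)
    then have "group.ord (nat_DirProd H K) (prod_encode (y, x)) = \<Prod>(insert p S)"
      using insert K y by (simp add: ord_nat_DirProd[OF grp] lcm_coprime)
    moreover have "prod_encode (y, x) \<in> carrier (nat_DirProd H K)"
      using K y by (auto simp: carrier_nat_DirProd)
    ultimately show ?case using formation_nat_DirProd[OF assms(1) H(1) K(1)] by blast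
  qed
  then obtain K x where K: "K \<in> \<FF>" "x \<in> carrier K" "group.ord K x = \<Prod>S" by blast
  then interpret group K using fg by (simp add: finite_group_def)
  \<comment> \<open>Such a \<open>K\<close> may have further prime divisors; the subgroup generated by the element does not.\<close>
  define A where "A = generate K {x}"
  let ?C = "K\<lparr>carrier := A\<rparr>"
  have A: "subgroup A K"
    unfolding A_def using K by (intro generate_is_subgroup) auto
  interpret C: group ?C by (rule subgroup.subgroup_is_group[OF A is_group])
  have xA: "x \<in> A" by (simp add: A_def generate.incl)
  have "?C \<in> \<FF>" using assms(2) K(1) A unfolding hereditary_def by blast
  moreover have "group_primes ?C = S"
  proof -
    have "card A = \<Prod>S" using generate_pow_card[OF K(2)] K(3) by (simp add: A_def)
    moreover have "0 \<notin> S" using S_prime not_prime_0 by metis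
    then have "prime_factors (\<Prod>S) = (\<Union>p\<in>S. prime_factors p)"
      using assms(4) prime_factors_prod[of S id] by simp
    ultimately show ?thesis
      using S_prime by (auto simp: group_primes_def order_def prime_prime_factors)
  qed
  moreover have "C.ord x = \<Prod>S"
    using K(2,3) xA C.ord_unique[of x "\<Prod>S"] pow_eq_id[OF K(2)]
    by (simp add: nat_pow_consistent[symmetric])
  ultimately show thesis using that xA by auto
qed

section \<open>Recognition by the prime graph\<close>

theorem theorem4p1:
  fixes \<FF> :: "nat monoid set" and \<pi> :: "nat set"
  assumes "formation \<FF>" and "hereditary \<FF>" and "\<FF> \<noteq> {}"
    and "\<pi> = class_primes \<FF>"
  shows "recognized_by \<FF> prime_graph \<longleftrightarrow> \<FF> = pi_groups \<pi>"
proof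
  assume "\<FF> = pi_groups \<pi>"
  then show "recognized_by \<FF> prime_graph"
    by (auto simp: recognized_by_def pi_groups_def prime_graph_def)
next
  assume rec: "recognized_by \<FF> prime_graph"
  note fg = formation_finite_group[OF assms(1)]
  show "\<FF> = pi_groups \<pi>"
  proof
    show "\<FF> \<subseteq> pi_groups \<pi>"
      using fg assms(4) by (auto simp: pi_groups_def class_primes_def)
  next
    show "pi_groups \<pi> \<subseteq> \<FF>"
    proof
      fix G assume "G \<in> pi_groups \<pi>"
      then have G: "finite_group G" "group_primes G \<subseteq> class_primes \<FF>"
        using assms(4) by (auto simp: pi_groups_def)
      have "finite (group_primes G)" by (simp add: group_primes_def)
      with G obtain C x where C: "C \<in> \<FF>" "group_primes C = group_primes G" "x \<in> carrier C"
        "group.ord C x = \<Prod>(group_primes G)"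
        using cyclic_in_hereditary_formation[OF assms(1-3)] by metis
      interpret G: group G using G by (simp add: finite_group_def)
      interpret C: group C using C fg by (simp add: finite_group_def)
      let ?P = "nat_DirProd G C"
      have P: "finite_group ?P" using G C fg finite_group_nat_DirProd by blast
      have primes: "group_primes ?P = group_primes G"
        using G C fg by (simp add: group_primes_nat_DirProd)
      have "group.ord ?P (prod_encode (\<one>\<^bsub>G\<^esub>, x)) = \<Prod>(group_primes ?P)"
        using C primes by (simp add: ord_nat_DirProd G.is_group C.is_group)
      moreover have "prod_encode (\<one>\<^bsub>G\<^esub>, x) \<in> carrier ?P"
        using C by (auto simp: carrier_nat_DirProd)
      ultimately have "prime_graph ?P = prime_graph C"
        using prime_graph_complete[OF P] prime_graph_complete[of C x] C fg primes by simp
      then have "?P \<in> \<FF>"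
        using rec C(1) fg[OF C(1)] P unfolding recognized_by_def by metis
      moreover have "(\<lambda>z. fst (prod_decode z)) \<in> epi ?P G"
        using nat_DirProd_fst_hom nat_DirProd_fst_surj[OF C.is_group] by (auto simp: epi_def)
      ultimately show "G \<in> \<FF>"
        using assms(1) G(1) unfolding formation_def by blast
    qed
  qed
qed

end
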